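(* Let $\mathbb X$ be a complete separable metric space with Borel $\sigma$-field $\mathcal X$. Let $\eta=\sum_{i=1}^{\tau}\delta_{X_i}$ be a mixed sampled point process on $\mathbb X$ for which $\tau\in\mathcal Q$. Then $\eta$ is negatively associated (NA).
   Context: Mixed sampled point process: $(X_i)_{i\ge1}$ is an i.i.d. sequence of random elements of $\mathbb X$ with common distribution $F$, $\tau$ is a random variable with values in $\{0,1,2,\dots\}$ independent of $(X_i)_{i\ge 1}$, and $\eta=\sum_{i=1}^{\tau}\delta_{X_i}$, where $\delta_x$ is the Dirac measure at $x$. Class $\mathcal Q$: for $n\ge1$, $\mathcal Q_n$ is the class of (distributions of) random variables of the form $U_1+\dots+U_n$ with $U_1,\dots,U_n$ independent Bernoulli ($\{0,1\}$-valued) variables with possibly different success probabilities. $\mathcal Q$ is the weak closure of $\bigcup_{n\ge1}\mathcal Q_n$, i.e. the class of all probability distributions supported in $\{0,1,2,\dots\}$ that are weak limits of distributions from $\bigcup_n\mathcal Q_n$. One writes $\tau\in\mathcal Q$ if the distribution of $\tau$ belongs to $\mathcal Q$. NA: a random vector $(Y_1,\dots,Y_n)$ is NA if for every $A\subseteq\{1,\dots,n\}$, $\mathrm{Cov}\big(f(Y_i,i\in A),g(Y_j,j\in A^c)\big)\le 0$ for all real functions $f,g$ that are non-decreasing (coordinatewise) and for which the covariance exists. A point process $\eta$ on $\mathbb X$ is NA if for every finite collection of disjoint sets $B_1,\dots,B_n\in\mathcal X$ the vector $(\eta(B_1),\dots,\eta(B_n))$ is NA. *)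

theory Defs
  imports "HOL-Probability.Probability"
begin

text \<open>
  Distributions on \<open>{0, 1, 2, \<dots>}\<close> are Borel measures on the reals, the setting of
  \<^const>\<open>weak_conv_m\<close>.
  \<open>bernoulli_sums n\<close> is the class of laws of \<open>U\<^sub>1 + \<dots> + U\<^sub>n\<close> with independent Bernoulli
  variables \<open>U\<^sub>i\<close>; \<^const>\<open>Pi_pmf\<close> is the joint law of \<open>(U\<^sub>1, \<dots>, U\<^sub>n)\<close>.
\<close>

definition bernoulli_sums :: "nat \<Rightarrow> real measure set" where
  "bernoulli_sums n =
     {distr (measure_pmf (Pi_pmf {1..n} False (\<lambda>i. bernoulli_pmf (p i)))) borel
        (\<lambda>u. \<Sum>i=1..n. of_bool (u i)) | p. \<forall>i\<in>{1..n}. 0 \<le> p i \<and> p i \<le> 1}"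

text \<open>
  The weak topology on distributions on the reals is metrizable, so limits of sequences give
  the whole weak closure.
\<close>

definition class_Q :: "real measure set" where
  "class_Q =
     {\<mu>. real_distribution \<mu> \<and> (AE x in \<mu>. x \<in> \<nat>) \<and>
         (\<exists>\<nu>. (\<forall>k. \<nu> k \<in> (\<Union>n\<in>{1..}. bernoulli_sums n)) \<and> weak_conv_m \<nu> \<mu>)}"

definition cov :: "'w measure \<Rightarrow> ('w \<Rightarrow> real) \<Rightarrow> ('w \<Rightarrow> real) \<Rightarrow> real" where
  "cov M U V =
     (\<integral>\<omega>. (U \<omega> - (\<integral>\<omega>'. U \<omega>' \<partial>M)) * (V \<omega> - (\<integral>\<omega>'. V \<omega>' \<partial>M)) \<partial>M)"

definition cov_exists :: "'w measure \<Rightarrow> ('w \<Rightarrow> real) \<Rightarrow> ('w \<Rightarrow> real) \<Rightarrow> bool" where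
  "cov_exists M U V \<longleftrightarrow>
     integrable M U \<and> integrable M V \<and> integrable M (\<lambda>\<omega>. U \<omega> * V \<omega>)"

text \<open>
  A vector indexed by \<open>A\<close> is an element of \<open>A \<rightarrow>\<^sub>E UNIV\<close>, on which the order of functions is
  the coordinatewise order of the coordinates in \<open>A\<close>.
\<close>

definition na_vector :: "'w measure \<Rightarrow> nat \<Rightarrow> (nat \<Rightarrow> 'w \<Rightarrow> real) \<Rightarrow> bool" where
  "na_vector M n Y \<longleftrightarrow>
     (\<forall>A f g. A \<subseteq> {1..n} \<longrightarrow>
        mono_on (A \<rightarrow>\<^sub>E UNIV) f \<longrightarrow> mono_on (({1..n} - A) \<rightarrow>\<^sub>E UNIV) g \<longrightarrow>
        cov_exists M (\<lambda>\<omega>. f (\<lambda>i\<in>A. Y i \<omega>)) (\<lambda>\<omega>. g (\<lambda>j\<in>{1..n} - A. Y j \<omega>)) \<longrightarrow>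
        cov M (\<lambda>\<omega>. f (\<lambda>i\<in>A. Y i \<omega>)) (\<lambda>\<omega>. g (\<lambda>j\<in>{1..n} - A. Y j \<omega>)) \<le> 0)"

definition finite_point_process ::
    "'w measure \<Rightarrow> ('w \<Rightarrow> 'a::topological_space measure) \<Rightarrow> bool" where
  "finite_point_process M \<eta> \<longleftrightarrow>
     (\<forall>\<omega>\<in>space M. sets (\<eta> \<omega>) = sets borel \<and>
        (\<forall>B\<in>sets borel. emeasure (\<eta> \<omega>) B \<in> range of_nat)) \<and>
     (\<forall>B\<in>sets borel. (\<lambda>\<omega>. emeasure (\<eta> \<omega>) B) \<in> borel_measurable M)"

text \<open>
  Finiteness is part of the definition because \<^const>\<open>measure\<close> is \<open>0\<close> on sets of infinite
  measure.
\<close>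

definition na_point_process ::
    "'w measure \<Rightarrow> ('w \<Rightarrow> 'a::topological_space measure) \<Rightarrow> bool" where
  "na_point_process M \<eta> \<longleftrightarrow> finite_point_process M \<eta> \<and>
     (\<forall>n B. (\<forall>i\<in>{1..n}. B i \<in> sets borel) \<longrightarrow> disjoint_family_on B {1..n} \<longrightarrow>
        na_vector M n (\<lambda>i \<omega>. measure (\<eta> \<omega>) (B i)))"

definition sampled_process ::
    "('w \<Rightarrow> nat) \<Rightarrow> (nat \<Rightarrow> 'w \<Rightarrow> 'a::topological_space) \<Rightarrow> 'w \<Rightarrow> 'a measure" where
  "sampled_process \<tau> X \<omega> =
     measure_of UNIV (sets borel) (\<lambda>B. \<Sum>i=1..\<tau> \<omega>. emeasure (return borel (X i \<omega>)) B)"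

lemma sets_sampled_process [simp]: "sets (sampled_process \<tau> X \<omega>) = sets borel"
  unfolding sampled_process_def
  using sets.sets_measure_of_eq[of borel] by simp

lemma emeasure_sampled_process:
  fixes X :: "nat \<Rightarrow> 'w \<Rightarrow> 'a::topological_space"
  assumes "B \<in> sets borel"
  shows "emeasure (sampled_process \<tau> X \<omega>) B
    = (\<Sum>i=1..\<tau> \<omega>. emeasure (return borel (X i \<omega>)) B)"
proof (rule emeasure_measure_of[OF sampled_process_def])
  show "sets borel \<subseteq> Pow UNIV" by simp
  show "B \<in> sets (sampled_process \<tau> X \<omega>)" using assms by simp
  show "positive (sets (sampled_process \<tau> X \<omega>))
      (\<lambda>B. \<Sum>i=1..\<tau> \<omega>. emeasure (return borel (X i \<omega>)) B)"
    by (simp add: positive_def)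
  show "countably_additive (sets (sampled_process \<tau> X \<omega>))
      (\<lambda>B. \<Sum>i=1..\<tau> \<omega>. emeasure (return borel (X i \<omega>)) B)"
  proof (rule countably_additiveI)
    fix A :: "nat \<Rightarrow> 'a set"
    assume A: "range A \<subseteq> sets (sampled_process \<tau> X \<omega>)" "disjoint_family A"
    have "(\<Sum>k. \<Sum>i=1..\<tau> \<omega>. emeasure (return borel (X i \<omega>)) (A k))
        = (\<Sum>i=1..\<tau> \<omega>. \<Sum>k. emeasure (return borel (X i \<omega>)) (A k))"
      by (rule suminf_sum) simp
    also have "\<dots> = (\<Sum>i=1..\<tau> \<omega>. emeasure (return borel (X i \<omega>)) (\<Union>k. A k))"
      using A by (intro sum.cong refl suminf_emeasure) auto
    finally show "(\<Sum>k. \<Sum>i=1..\<tau> \<omega>. emeasure (return borel (X i \<omega>)) (A k))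
        = (\<Sum>i=1..\<tau> \<omega>. emeasure (return borel (X i \<omega>)) (\<Union>k. A k))" .
  qed
qed

end

theory Submission
  imports Defs
begin

text \<open>
  For disjoint sets \<open>B\<^sub>1, \<dots>, B\<^sub>n\<close> the counts \<open>\<eta>(B\<^sub>1), \<dots>, \<eta>(B\<^sub>n)\<close> arise by adding one point at a
  time, each point falling into \<open>B\<^sub>k\<close> with a fixed probability \<open>p\<^sub>k\<close>, or into none of the sets with
  probability \<open>p\<^sub>0\<close>. If \<open>K\<close> denotes the averaging operator
  \<open>K h s = (\<Sum>k\<le>n. p\<^sub>k * h (s + e\<^sub>k))\<close> on functions of the vector of counts, then the mean of \<open>h\<close> after
  \<open>m\<close> points is \<open>K\<^sup>m h 0\<close> (\<open>expectation_counts\<close>), and, \<open>\<tau>\<close> being independent of the points, the mean of \<open>h\<close>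
  at the counts is the mean of \<open>K\<^sup>\<tau> h 0\<close>.

  If \<open>\<tau>\<close> is a sum of independent Bernoulli variables with parameters \<open>r\<^sub>1, \<dots>, r\<^sub>N\<close>, then this mean is
  obtained by applying to \<open>h\<close> the operators \<open>L\<^sub>r = (1 - r) I + r K\<close> for \<open>r = r\<^sub>1, \<dots>, r\<^sub>N\<close>. One operator
  already produces the negative correlation: if \<open>f\<close> and \<open>g\<close> are increasing and depend on disjoint
  sets of coordinates, then a new point changes at most one of them, so the two increments have
  product zero and \<open>L\<^sub>r (f g) \<le> L\<^sub>r f * L\<^sub>r g\<close> (\<open>thin_mult_le\<close>). The functions \<open>L\<^sub>r f\<close> and \<open>L\<^sub>r g\<close> are
  again increasing in the same coordinates and the operators preserve inequalities, so the estimate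
  propagates through all \<open>N\<close> summands (\<open>bernoulli_mean_mult_le\<close>).

  For general \<open>\<tau>\<close> in the class and bounded \<open>f\<close> and \<open>g\<close>, all means are integrals of bounded functions of
  \<open>\<tau>\<close>, which extend to functions on the reals that are locally constant near every natural number;
  hence they pass to the weak limit (\<open>class_Q_mult_le\<close>). Unbounded \<open>f\<close> and \<open>g\<close> are clipped to
  \<open>[-t, t]\<close>, which keeps them increasing, and \<open>t\<close> tends to infinity by dominated convergence
  (\<open>cov_nonpos_if_clipped\<close>).
\<close>

section \<open>Increasing functions of the counts\<close>

definition add_point :: "nat \<Rightarrow> (nat \<Rightarrow> nat) \<Rightarrow> nat \<Rightarrow> nat" where
  "add_point k s = s(k := Suc (s k))"

lemma add_point_commute: "add_point j (add_point k s) = add_point k (add_point j s)"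
  by (auto simp: add_point_def)

text \<open>
  Monotonicity in the coordinates \<open>A\<close> and independence of all others, expressed through single added
  points, since points are added one at a time. Coordinate \<open>0\<close> is reserved for points in none of the sets; it
  belongs neither to \<open>A\<close> nor to its complement in \<open>{1..n}\<close>.
\<close>
definition increases_in :: "nat set \<Rightarrow> ((nat \<Rightarrow> nat) \<Rightarrow> real) \<Rightarrow> bool" where
  "increases_in A f \<longleftrightarrow>
     (\<forall>s k. f s \<le> f (add_point k s) \<and> (k \<notin> A \<longrightarrow> f (add_point k s) = f s))"

lemma increases_in_restrict:
  assumes "mono_on (A \<rightarrow>\<^sub>E UNIV) (f :: (nat \<Rightarrow> real) \<Rightarrow> real)"
  shows "increases_in A (\<lambda>s. f (\<lambda>i\<in>A. real (s i)))"
  unfolding increases_in_def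
proof (intro allI conjI impI)
  fix s k
  show "f (\<lambda>i\<in>A. real (s i)) \<le> f (\<lambda>i\<in>A. real (add_point k s i))"
    by (rule mono_onD[OF assms]) (auto simp: le_fun_def add_point_def)
  assume "k \<notin> A"
  then have "(\<lambda>i\<in>A. real (add_point k s i)) = (\<lambda>i\<in>A. real (s i))"
    by (auto simp: add_point_def fun_eq_iff)
  then show "f (\<lambda>i\<in>A. real (add_point k s i)) = f (\<lambda>i\<in>A. real (s i))"
    by simp
qed

definition clip :: "real \<Rightarrow> real \<Rightarrow> real" where
  "clip t x = max (- t) (min t x)"

lemma abs_clip_le: "0 \<le> t \<Longrightarrow> \<bar>clip t x\<bar> \<le> t" "0 \<le> t \<Longrightarrow> \<bar>clip t x\<bar> \<le> \<bar>x\<bar>"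
  by (auto simp: clip_def)

lemma borel_measurable_clip [measurable]: "clip t \<in> borel_measurable borel"
  unfolding clip_def[abs_def] by measurable

lemma clip_tendsto: "(\<lambda>m. clip (real m) x) \<longlonglongrightarrow> x"
proof (rule tendsto_eventually)
  obtain m0 :: nat where "\<bar>x\<bar> \<le> real m0"
    using real_arch_simple by blast
  then have "clip (real m) x = x" if "m \<ge> m0" for m
    using that by (auto simp: clip_def)
  then show "\<forall>\<^sub>F m in sequentially. clip (real m) x = x"
    by (auto simp: eventually_sequentially)
qed

lemma increases_in_clip: "increases_in A f \<Longrightarrow> increases_in A (\<lambda>s. clip t (f s))"
  unfolding increases_in_def clip_def by (smt (verit))

section \<open>Adding random points\<close>

text \<open>
  A sequence of reals indexed by the naturals is extended to the real line by rounding the argument,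
  so that a law on the naturals given as a Borel measure on the reals can be integrated against it.
\<close>
lemma borel_measurable_nat_round:
  "(\<lambda>x :: real. c (nat (round x)) :: real) \<in> borel_measurable borel"
  unfolding round_def by measurable

text \<open>
  The distribution of the index of the set hit by one point, index \<open>0\<close> standing for no set.
\<close>
locale sampling_weights =
  fixes n :: nat and p :: "nat \<Rightarrow> real"
  assumes weight_nonneg: "0 \<le> p k"
    and sum_weights: "(\<Sum>k\<le>n. p k) = 1"
begin

definition sample :: "((nat \<Rightarrow> nat) \<Rightarrow> real) \<Rightarrow> (nat \<Rightarrow> nat) \<Rightarrow> real" where
  "sample h s = (\<Sum>k\<le>n. p k * h (add_point k s))"

text \<open>
  The mean of \<open>h\<close> after adding a random point with probability \<open>r\<close>, the effect of one Bernoulli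
  summand of \<open>\<tau>\<close>.
\<close>
definition thin :: "real \<Rightarrow> ((nat \<Rightarrow> nat) \<Rightarrow> real) \<Rightarrow> (nat \<Rightarrow> nat) \<Rightarrow> real" where
  "thin r h s = (1 - r) * h s + r * sample h s"

lemma sample_mono: "(\<And>s. f s \<le> g s) \<Longrightarrow> sample f s \<le> sample g s"
  unfolding sample_def by (intro sum_mono mult_left_mono weight_nonneg)

lemma funpow_sample_mono: "(\<And>s. f s \<le> g s) \<Longrightarrow> (sample ^^ m) f s \<le> (sample ^^ m) g s"
  by (induction m arbitrary: s) (auto intro: sample_mono)

lemma sample_const: "sample (\<lambda>_. c) = (\<lambda>_. c)"
  by (simp add: sample_def fun_eq_iff sum_weights flip: sum_distrib_right)

lemma abs_funpow_sample_le:
  assumes "\<And>s. \<bar>h s\<bar> \<le> c"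
  shows "\<bar>(sample ^^ m) h s\<bar> \<le> c"
proof -
  have const: "(sample ^^ m) (\<lambda>_. d) = (\<lambda>_. d)" for d
    by (induction m) (simp_all add: sample_const)
  have "(sample ^^ m) h s \<le> c" "- c \<le> (sample ^^ m) h s"
    using funpow_sample_mono[of h "\<lambda>_. c" m s] funpow_sample_mono[of "\<lambda>_. - c" h m s] assms
    by (auto simp: const abs_le_iff minus_le_iff)
  then show ?thesis by linarith
qed

lemma funpow_sample_lincomb:
  "(sample ^^ m) (\<lambda>s. a * f s + b * g s) s = a * (sample ^^ m) f s + b * (sample ^^ m) g s"
proof (induction m arbitrary: s)
  case (Suc m)
  then show ?case
    by (simp add: sample_def sum_distrib_left sum.distrib algebra_simps)
qed simp

text \<open>
  Every added random point can be exchanged with a given one, because adding points commutes.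
\<close>
lemma increases_in_thin:
  assumes f: "increases_in A f" and r: "0 \<le> r" "r \<le> 1"
  shows "increases_in A (thin r f)"
  unfolding increases_in_def
proof (intro allI conjI impI)
  fix s k
  have "sample f s \<le> sample f (add_point k s)"
    unfolding sample_def using f
    by (intro sum_mono mult_left_mono weight_nonneg)
      (metis add_point_commute increases_in_def)
  with f r show "thin r f s \<le> thin r f (add_point k s)"
    unfolding thin_def increases_in_def by (intro add_mono mult_left_mono) auto
  assume "k \<notin> A"
  with f have "f (add_point k s) = f s" "sample f (add_point k s) = sample f s"
    unfolding sample_def increases_in_def by (auto simp: add_point_commute[of _ k])
  then show "thin r f (add_point k s) = thin r f s"
    by (simp add: thin_def)
qed

text \<open>
  Write \<open>a\<^sub>k, b\<^sub>k \<ge> 0\<close> for the increments of \<open>f\<close> and \<open>g\<close> when a point is added at \<open>k\<close>, and \<open>\<alpha>, \<beta>\<close> for their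
  weighted sums. As \<open>a\<^sub>k b\<^sub>k = 0\<close>, the left hand side is \<open>f g + r (f \<beta> + g \<alpha>)\<close>, whereas the right
  hand side is \<open>(f + r \<alpha>) (g + r \<beta>)\<close>; they differ by \<open>r\<^sup>2 \<alpha> \<beta> \<ge> 0\<close>.
\<close>
lemma thin_mult_le:
  assumes f: "increases_in A f" and g: "increases_in B g" and disj: "A \<inter> B = {}"
  shows "thin r (\<lambda>s. f s * g s) s \<le> thin r f s * thin r g s"
proof -
  define a where "a k = f (add_point k s) - f s" for k
  define b where "b k = g (add_point k s) - g s" for k
  define \<alpha> where "\<alpha> = (\<Sum>k\<le>n. p k * a k)"
  define \<beta> where "\<beta> = (\<Sum>k\<le>n. p k * b k)"
  have ab: "0 \<le> a k" "0 \<le> b k" "a k * b k = 0" for k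
    using f g disj unfolding a_def b_def increases_in_def by (simp_all, blast)
  have sample_f: "sample f s = f s + \<alpha>"
    using sum_weights by (simp add: sample_def \<alpha>_def a_def algebra_simps sum_subtractf
      flip: sum_distrib_left)
  have sample_g: "sample g s = g s + \<beta>"
    using sum_weights by (simp add: sample_def \<beta>_def b_def algebra_simps sum_subtractf
      flip: sum_distrib_left)
  have "p k * (f (add_point k s) * g (add_point k s))
      = f s * g s * p k + f s * (p k * b k) + g s * (p k * a k)" for k
  proof -
    have "f (add_point k s) * g (add_point k s) = f s * g s + f s * b k + g s * a k + a k * b k"
      by (simp add: a_def b_def algebra_simps)
    then show ?thesis
      using ab(3)[of k] by (simp add: algebra_simps)
  qed
  then have sample_fg: "sample (\<lambda>s. f s * g s) s = f s * g s + f s * \<beta> + g s * \<alpha>"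
    by (simp add: sample_def \<alpha>_def \<beta>_def sum.distrib sum_weights flip: sum_distrib_left)
  have "thin r f s * thin r g s - thin r (\<lambda>s. f s * g s) s = (r * r) * (\<alpha> * \<beta>)"
    unfolding thin_def sample_f sample_g sample_fg by algebra
  moreover have "0 \<le> (r * r) * (\<alpha> * \<beta>)"
    unfolding \<alpha>_def \<beta>_def by (intro mult_nonneg_nonneg sum_nonneg weight_nonneg ab zero_le_square)
  ultimately show ?thesis by linarith
qed

text \<open>
  The mean of \<open>h\<close> after a random number of added points, this number being a sum of independent
  Bernoulli variables.
\<close>
definition bernoulli_mean ::
    "nat set \<Rightarrow> (nat \<Rightarrow> real) \<Rightarrow> ((nat \<Rightarrow> nat) \<Rightarrow> real) \<Rightarrow> (nat \<Rightarrow> nat) \<Rightarrow> real" where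
  "bernoulli_mean I r h s =
     measure_pmf.expectation (Pi_pmf I False (\<lambda>i. bernoulli_pmf (r i)))
       (\<lambda>u. (sample ^^ (\<Sum>i\<in>I. of_bool (u i))) h s)"

lemma finite_set_Pi_bernoulli:
  "finite I \<Longrightarrow> finite (set_pmf (Pi_pmf I False (\<lambda>i. bernoulli_pmf (r i))))"
  by (rule finite_subset[OF set_Pi_pmf_subset']) (auto intro!: finite_PiE_dflt)

text \<open>
  The operators \<open>L\<^sub>r\<close> commute; placing the one of the new summand innermost lets the induction below
  invoke its hypothesis for the thinned functions.
\<close>
lemma bernoulli_mean_insert:
  assumes I: "finite I" "j \<notin> I" and r: "0 \<le> r j" "r j \<le> 1"
  shows "bernoulli_mean (insert j I) r h s = bernoulli_mean I r (thin (r j) h) s"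
proof -
  let ?P = "Pi_pmf I False (\<lambda>i. bernoulli_pmf (r i))"
  let ?c = "\<lambda>u. (\<Sum>i\<in>I. of_bool (u i)) :: nat"
  note int = integrable_measure_pmf_finite[OF finite_set_Pi_bernoulli[OF I(1)]]
  have upd: "(\<Sum>i\<in>insert j I. of_bool ((u(j := b)) i)) = of_bool b + ?c u" for u b
  proof -
    have "(\<Sum>i\<in>I. of_bool ((u(j := b)) i)) = ?c u"
      using I(2) by (intro sum.cong) auto
    with I show ?thesis by (simp del: sum_of_bool_eq fun_upd_apply add: fun_upd_same)
  qed
  have "bernoulli_mean (insert j I) r h s =
      (\<Sum>b\<in>UNIV. pmf (bernoulli_pmf (r j)) b *
         measure_pmf.expectation ?P (\<lambda>u. (sample ^^ (of_bool b + ?c u)) h s))"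
    unfolding bernoulli_mean_def Pi_pmf_insert'[OF I]
    by (subst pmf_expectation_bind[where A = UNIV])
      (auto simp: finite_set_Pi_bernoulli I(1) upd simp del: sum_of_bool_eq fun_upd_apply
        simp flip: map_pmf_def)
  also have "\<dots> = (1 - r j) * measure_pmf.expectation ?P (\<lambda>u. (sample ^^ ?c u) h s)
      + r j * measure_pmf.expectation ?P (\<lambda>u. (sample ^^ ?c u) (sample h) s)"
    using r by (simp add: UNIV_bool funpow_swap1)
  also have "\<dots> = bernoulli_mean I r (thin (r j) h) s"
    unfolding bernoulli_mean_def thin_def[abs_def] funpow_sample_lincomb
    by (simp add: int)
  finally show ?thesis .
qed

lemma bernoulli_mean_mono:
  assumes "finite I" "\<And>s. f s \<le> g s"
  shows "bernoulli_mean I r f s \<le> bernoulli_mean I r g s"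
  unfolding bernoulli_mean_def
  by (intro integral_mono integrable_measure_pmf_finite finite_set_Pi_bernoulli
      funpow_sample_mono assms)

text \<open>
  The one-step inequality is applied inside the mean over the other summands; the induction hypothesis
  then applies to the thinned functions, which are increasing in the same coordinates.
\<close>
lemma bernoulli_mean_mult_le:
  assumes "finite I" "\<forall>i\<in>I. 0 \<le> r i \<and> r i \<le> 1"
    and "increases_in A f" "increases_in B g" "A \<inter> B = {}"
  shows "bernoulli_mean I r (\<lambda>s. f s * g s) s \<le> bernoulli_mean I r f s * bernoulli_mean I r g s"
  using assms
proof (induction I arbitrary: f g rule: finite_induct)
  case empty
  then show ?case by (simp add: bernoulli_mean_def)
next
  case (insert j I)
  then have r: "0 \<le> r j" "r j \<le> 1" "\<forall>i\<in>I. 0 \<le> r i \<and> r i \<le> 1"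
    by auto
  have "bernoulli_mean I r (thin (r j) (\<lambda>s. f s * g s)) s
      \<le> bernoulli_mean I r (\<lambda>s. thin (r j) f s * thin (r j) g s) s"
    using insert.prems insert.hyps by (intro bernoulli_mean_mono thin_mult_le)
  also have "\<dots> \<le> bernoulli_mean I r (thin (r j) f) s * bernoulli_mean I r (thin (r j) g) s"
    using r insert.prems by (intro insert.IH increases_in_thin)
  finally show ?case
    using insert.hyps r by (simp add: bernoulli_mean_insert)
qed

lemma integral_bernoulli_sum:
  "(\<integral>x. (sample ^^ nat (round (x :: real))) h s \<partial>distr
      (measure_pmf (Pi_pmf {1..N} False (\<lambda>i. bernoulli_pmf (r i)))) borel
      (\<lambda>u. \<Sum>i=1..N. of_bool (u i)))
    = bernoulli_mean {1..N} r h s"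
proof -
  have *: "nat (round (\<Sum>i=1..N. of_bool (u i) :: real)) = (\<Sum>i=1..N. of_bool (u i))"
    for u :: "nat \<Rightarrow> bool"
    by simp
  have meas: "(\<lambda>u. \<Sum>i=1..N. of_bool (u i) :: real) \<in> borel_measurable
      (measure_pmf (Pi_pmf {1..N} False (\<lambda>i. bernoulli_pmf (r i))))"
    by simp
  show ?thesis
    unfolding bernoulli_mean_def
      integral_distr[OF meas borel_measurable_nat_round[of "\<lambda>m. (sample ^^ m) h s"]] * ..
qed

end

section \<open>Weak limits\<close>

lemma bernoulli_sums_real_distribution: "\<nu> \<in> bernoulli_sums N \<Longrightarrow> real_distribution \<nu>"
  unfolding bernoulli_sums_def
  by (auto intro!: prob_space.real_distribution_distr[OF measure_pmf.prob_space_axioms])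

text \<open>
  Weak convergence gives convergence of integrals only for functions that are almost everywhere
  continuous. Extending \<open>c\<close> by rounding makes it locally constant around each natural number, and the
  limit law is concentrated on the naturals.
\<close>
lemma class_Q_approximation:
  assumes "\<mu> \<in> class_Q"
  obtains \<nu> :: "nat \<Rightarrow> real measure"
  where "\<And>k. \<exists>N. \<nu> k \<in> bernoulli_sums N"
    and "\<And>(c :: nat \<Rightarrow> real) C. (\<And>m. \<bar>c m\<bar> \<le> C) \<Longrightarrow>
      (\<lambda>k. \<integral>x. c (nat (round x)) \<partial>\<nu> k) \<longlonglongrightarrow> (\<integral>x. c (nat (round x)) \<partial>\<mu>)"
proof -
  obtain \<nu> where \<mu>: "real_distribution \<mu>" "AE x in \<mu>. x \<in> \<nat>"
    and \<nu>: "\<And>k. \<nu> k \<in> (\<Union>n\<in>{1..}. bernoulli_sums n)" and conv: "weak_conv_m \<nu> \<mu>"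
    using assms unfolding class_Q_def by auto
  interpret \<mu>: real_distribution \<mu> by fact
  have dist: "real_distribution (\<nu> k)" for k
    using \<nu>[of k] bernoulli_sums_real_distribution by auto
  have "(\<lambda>k. \<integral>x. c (nat (round x)) \<partial>\<nu> k) \<longlonglongrightarrow> (\<integral>x. c (nat (round x)) \<partial>\<mu>)"
    if C: "\<And>m. \<bar>c m\<bar> \<le> C" for c :: "nat \<Rightarrow> real" and C
  proof (rule weak_conv_imp_bdd_ae_continuous_conv[OF dist \<mu>(1) conv])
    show [measurable]: "(\<lambda>x :: real. c (nat (round x))) \<in> borel_measurable borel"
      by (rule borel_measurable_nat_round)
    show "norm (c (nat (round x))) \<le> C" for x :: real
      using C by simp
    have "isCont (\<lambda>x :: real. c (nat (round x))) x" if x: "x \<in> \<nat>" for x :: real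
    proof -
      obtain m where m: "x = real m" using x by (auto elim: Nats_cases)
      have "\<forall>\<^sub>F y in nhds x. y \<in> {x - 1/2 <..< x + 1/2}"
        by (rule eventually_nhds_in_open) auto
      then have "\<forall>\<^sub>F y in nhds x. c (nat (round y)) = c m"
      proof eventually_elim
        case (elim y)
        then have "round y = int m"
          using m by (intro round_unique') (auto simp: abs_if)
        then show ?case by simp
      qed
      then have "isCont (\<lambda>x :: real. c (nat (round x))) x \<longleftrightarrow> isCont (\<lambda>_ :: real. c m) x"
        by (rule isCont_cong)
      then show ?thesis by simp
    qed
    then have "{x. \<not> isCont (\<lambda>x :: real. c (nat (round x))) x} \<subseteq> {x. x \<notin> \<nat>}"
      by auto
    moreover have [measurable]: "(\<nat> :: real set) \<in> sets borel"
      by (rule sets.countable) (auto simp: Nats_def)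
    have "{x :: real. x \<notin> \<nat>} \<in> sets \<mu>"
      by measurable
    ultimately show "emeasure \<mu> {x. \<not> isCont (\<lambda>x :: real. c (nat (round x))) x} = 0"
      using \<mu>(2) by (metis (no_types, lifting) AE_iff_null emeasure_mono le_zero_eq null_setsD1
          \<mu>.space_eq_univ Collect_cong UNIV_I)
  qed
  with \<nu> show ?thesis by (intro that[of \<nu>]) blast+
qed

lemma (in sampling_weights) class_Q_mult_le:
  assumes \<mu>: "\<mu> \<in> class_Q"
    and f: "increases_in A f" "\<And>s. \<bar>f s\<bar> \<le> C"
    and g: "increases_in B g" "\<And>s. \<bar>g s\<bar> \<le> C"
    and disj: "A \<inter> B = {}"
  shows "(\<integral>x. (sample ^^ nat (round x)) (\<lambda>s. f s * g s) s \<partial>\<mu>)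
    \<le> (\<integral>x. (sample ^^ nat (round x)) f s \<partial>\<mu>) * (\<integral>x. (sample ^^ nat (round x)) g s \<partial>\<mu>)"
proof -
  obtain \<nu> :: "nat \<Rightarrow> real measure" where \<nu>: "\<And>k. \<exists>N. \<nu> k \<in> bernoulli_sums N"
    and lim: "\<And>(c :: nat \<Rightarrow> real) C. (\<And>m. \<bar>c m\<bar> \<le> C) \<Longrightarrow>
      (\<lambda>k. \<integral>x. c (nat (round x)) \<partial>\<nu> k) \<longlonglongrightarrow> (\<integral>x. c (nat (round x)) \<partial>\<mu>)"
    using class_Q_approximation[OF \<mu>] by blast
  have fg: "\<bar>f s * g s\<bar> \<le> C * C" for s
    using mult_mono[OF f(2)[of s] g(2)[of s]] f(2)[of s] by (simp add: abs_mult)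
  note lim_h = lim[OF abs_funpow_sample_le]
  show ?thesis
  proof (rule LIMSEQ_le[OF lim_h tendsto_mult[OF lim_h lim_h]])
    have "(\<integral>x. (sample ^^ nat (round x)) (\<lambda>s. f s * g s) s \<partial>\<nu> k)
      \<le> (\<integral>x. (sample ^^ nat (round x)) f s \<partial>\<nu> k) * (\<integral>x. (sample ^^ nat (round x)) g s \<partial>\<nu> k)"
      for k
    proof -
      obtain N where "\<nu> k \<in> bernoulli_sums N" using \<nu> by blast
      then obtain r where r: "\<forall>i\<in>{1..N}. 0 \<le> r i \<and> r i \<le> 1"
        and "\<nu> k = distr (measure_pmf (Pi_pmf {1..N} False (\<lambda>i. bernoulli_pmf (r i)))) borel
          (\<lambda>u. \<Sum>i=1..N. of_bool (u i))"
        unfolding bernoulli_sums_def by blast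
      then show ?thesis
        using bernoulli_mean_mult_le[OF _ r f(1) g(1) disj] by (simp only: integral_bernoulli_sum finite_atLeastAtMost)
    qed
    then show "\<exists>K. \<forall>k\<ge>K. (\<integral>x. (sample ^^ nat (round x)) (\<lambda>s. f s * g s) s \<partial>\<nu> k)
      \<le> (\<integral>x. (sample ^^ nat (round x)) f s \<partial>\<nu> k) * (\<integral>x. (sample ^^ nat (round x)) g s \<partial>\<nu> k)"
      by blast
  qed (fact f(2) g(2) fg)+
qed

section \<open>The counts of a sample\<close>

text \<open>
  The point \<open>x i\<close> is recorded at the index \<open>\<kappa> (x i)\<close>; indices start at \<open>1\<close> as in the sampled process.
\<close>
primrec counts :: "('a \<Rightarrow> nat) \<Rightarrow> nat \<Rightarrow> (nat \<Rightarrow> 'a) \<Rightarrow> nat \<Rightarrow> nat" where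
  "counts \<kappa> 0 x = (\<lambda>_. 0)"
| "counts \<kappa> (Suc m) x = add_point (\<kappa> (x (Suc m))) (counts \<kappa> m x)"

lemma counts_eq_sum: "counts \<kappa> m x k = (\<Sum>i=1..m. of_bool (\<kappa> (x i) = k))"
  by (induction m) (auto simp: add_point_def simp del: sum_of_bool_eq)

lemma counts_restrict: "{1..m} \<subseteq> I \<Longrightarrow> counts \<kappa> m (restrict x I) = counts \<kappa> m x"
  by (simp add: fun_eq_iff counts_eq_sum subset_iff del: sum_of_bool_eq)

text \<open>
  Arbitrary functions \<open>h\<close> of the counts are measurable, since the index of each point takes countably
  many values.
\<close>
lemma borel_measurable_counts:
  assumes \<kappa> [measurable]: "\<kappa> \<in> measurable N (count_space UNIV)" and I: "{1..m} \<subseteq> I"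
  shows "(\<lambda>x. h (counts \<kappa> m x) :: real) \<in> borel_measurable (PiM I (\<lambda>_. N))"
  using I
proof (induction m arbitrary: h)
  case (Suc m)
  have "{1..m} \<subseteq> I" using Suc.prems by auto
  then have [measurable]: "(\<lambda>x. h (add_point k (counts \<kappa> m x))) \<in> borel_measurable (PiM I (\<lambda>_. N))" for k
    by (rule Suc.IH)
  have [simp]: "Suc m \<in> I" using Suc.prems by auto
  have "(\<lambda>x. (\<lambda>k x. h (add_point k (counts \<kappa> m x))) (\<kappa> (x (Suc m))) x)
      \<in> borel_measurable (PiM I (\<lambda>_. N))"
    by (rule measurable_compose_countable) measurable
  then show ?case by simp
qed simp

text \<open>
  The last point is independent of the counts of the earlier ones, so averaging over its index replaces
  \<open>h\<close> by \<open>sample h\<close>.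
\<close>
lemma (in sampling_weights) expectation_counts:
  fixes M :: "'w measure" and N :: "'a measure"
  assumes M: "prob_space M" and indep: "prob_space.indep_vars M (\<lambda>_. N) X {1..}"
    and \<kappa> [measurable]: "\<kappa> \<in> measurable N (count_space UNIV)" and \<kappa>_le: "\<And>x. \<kappa> x \<le> n"
    and weight: "\<And>i k. 1 \<le> i \<Longrightarrow> (\<integral>\<omega>. of_bool (\<kappa> (X i \<omega>) = k) \<partial>M) = p k"
    and h: "\<And>s. \<bar>h s\<bar> \<le> C"
  shows "(\<integral>\<omega>. h (counts \<kappa> m (\<lambda>i. X i \<omega>)) \<partial>M) = (sample ^^ m) h (\<lambda>_. 0)"
  using h
proof (induction m arbitrary: h)
  case 0
  interpret prob_space M by fact
  show ?case by (simp add: prob_space)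
next
  case (Suc m)
  interpret prob_space M by fact
  have X [measurable]: "X i \<in> measurable M N" if "1 \<le> i" for i
    using indep that unfolding indep_vars_def by auto
  let ?S = "\<lambda>\<omega>. counts \<kappa> m (\<lambda>i. X i \<omega>)"
  let ?b = "\<lambda>k \<omega>. of_bool (\<kappa> (X (Suc m) \<omega>) = k) :: real"
  have ind: "indep_var borel (?b k) borel (\<lambda>\<omega>. g (?S \<omega>))" for k and g :: "_ \<Rightarrow> real"
  proof -
    have "indep_var borel ((\<lambda>x. of_bool (\<kappa> (x (Suc m)) = k) :: real) \<circ> (\<lambda>\<omega>. \<lambda>i\<in>{Suc m}. X i \<omega>))
        borel ((\<lambda>x. g (counts \<kappa> m x)) \<circ> (\<lambda>\<omega>. \<lambda>i\<in>{1..m}. X i \<omega>))"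
      by (rule indep_var_compose[OF indep_var_restrict[OF indep]])
        (auto intro!: borel_measurable_counts \<kappa>)
    then show ?thesis
      by (simp add: o_def counts_restrict)
  qed
  have meas [measurable]: "(\<lambda>\<omega>. g (?S \<omega>)) \<in> borel_measurable M" for g :: "_ \<Rightarrow> real"
    using indep_var_rv2[OF ind] .
  have meas_b [measurable]: "?b k \<in> borel_measurable M" for k
    using indep_var_rv1[OF ind] .
  have int_b: "integrable M (?b k)" for k
    by (rule integrable_const_bound[where B = 1]) auto
  have int_h: "integrable M (\<lambda>\<omega>. h (add_point k (?S \<omega>)))" for k
    using Suc.prems by (intro integrable_const_bound[where B = C]) auto
  have "h (counts \<kappa> (Suc m) (\<lambda>i. X i \<omega>)) = (\<Sum>k\<le>n. ?b k \<omega> * h (add_point k (?S \<omega>)))" for \<omega>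
  proof -
    have "(\<Sum>k\<le>n. ?b k \<omega> * h (add_point k (?S \<omega>)))
        = (\<Sum>k\<le>n. if k = \<kappa> (X (Suc m) \<omega>) then h (add_point k (?S \<omega>)) else 0)"
      by (intro sum.cong) auto
    then show ?thesis
      using \<kappa>_le by simp
  qed
  then have "(\<integral>\<omega>. h (counts \<kappa> (Suc m) (\<lambda>i. X i \<omega>)) \<partial>M)
      = (\<integral>\<omega>. (\<Sum>k\<le>n. ?b k \<omega> * h (add_point k (?S \<omega>))) \<partial>M)"
    by presburger
  also have "\<dots> = (\<Sum>k\<le>n. p k * (\<integral>\<omega>. h (add_point k (?S \<omega>)) \<partial>M))"
    using indep_var_lebesgue_integral[OF ind int_b int_h] indep_var_integrable[OF ind int_b int_h]
    by (subst Bochner_Integration.integral_sum) (simp_all only: weight)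
  also have "\<dots> = (\<integral>\<omega>. sample h (?S \<omega>) \<partial>M)"
    using int_h by (simp add: sample_def)
  also have "\<dots> = (sample ^^ m) (sample h) (\<lambda>_. 0)"
    using Suc.prems abs_funpow_sample_le[of h C 1] by (intro Suc.IH) simp
  finally show ?case by (simp add: funpow_swap1)
qed

text \<open>
  Fubini's theorem for the product law of \<open>\<tau>\<close> and \<open>Y\<close>. Independence is stated for the generated
  \<open>\<sigma>\<close>-algebras because the two variables take values in different types, whereas \<open>indep_var\<close>
  relates variables of one type.
\<close>
lemma (in prob_space) expectation_indep_nat:
  fixes \<tau> :: "'a \<Rightarrow> nat" and H :: "nat \<Rightarrow> 'b \<Rightarrow> real"
  assumes \<tau> [measurable]: "\<tau> \<in> measurable M (count_space UNIV)" and Y [measurable]: "Y \<in> measurable M N"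
    and indep: "indep_set (sets (vimage_algebra (space M) \<tau> (count_space UNIV)))
      (sets (vimage_algebra (space M) Y N))"
    and H [measurable]: "\<And>m. H m \<in> borel_measurable N" and C: "\<And>m y. \<bar>H m y\<bar> \<le> C"
  shows "expectation (\<lambda>\<omega>. H (\<tau> \<omega>) (Y \<omega>)) = expectation (\<lambda>\<omega>. \<integral>\<omega>'. H (\<tau> \<omega>) (Y \<omega>') \<partial>M)"
proof -
  let ?S = "count_space (UNIV :: nat set)"
  interpret D\<tau>: prob_space "distr M ?S \<tau>" by (rule prob_space_distr) fact
  interpret DY: prob_space "distr M N Y" by (rule prob_space_distr) fact
  have joint: "distr M ?S \<tau> \<Otimes>\<^sub>M distr M N Y = distr M (?S \<Otimes>\<^sub>M N) (\<lambda>\<omega>. (\<tau> \<omega>, Y \<omega>))"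
  proof (rule pair_measure_eqI)
    fix A B assume "A \<in> sets (distr M ?S \<tau>)" "B \<in> sets (distr M N Y)"
    then have B [measurable]: "B \<in> sets N" by simp
    have "\<tau> -` A \<inter> space M \<in> sets (vimage_algebra (space M) \<tau> ?S)"
      "Y -` B \<inter> space M \<in> sets (vimage_algebra (space M) Y N)"
      using B by (auto intro: in_vimage_algebra)
    then have "prob ((\<tau> -` A \<inter> space M) \<inter> (Y -` B \<inter> space M))
        = prob (\<tau> -` A \<inter> space M) * prob (Y -` B \<inter> space M)"
      using indep by (auto simp: indep_sets2_eq)
    moreover have "(\<lambda>\<omega>. (\<tau> \<omega>, Y \<omega>)) -` (A \<times> B) \<inter> space M
        = (\<tau> -` A \<inter> space M) \<inter> (Y -` B \<inter> space M)"
      by auto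
    ultimately show "emeasure (distr M ?S \<tau>) A * emeasure (distr M N Y) B
        = emeasure (distr M (?S \<Otimes>\<^sub>M N) (\<lambda>\<omega>. (\<tau> \<omega>, Y \<omega>))) (A \<times> B)"
      by (simp add: emeasure_distr emeasure_eq_measure ennreal_mult)
  qed (simp_all add: D\<tau>.sigma_finite_measure_axioms DY.sigma_finite_measure_axioms,
      intro sets_pair_measure_cong sets_distr)
  interpret pair: pair_prob_space "distr M ?S \<tau>" "distr M N Y" ..
  have meas [measurable]: "(\<lambda>(m, y). H m y) \<in> borel_measurable (?S \<Otimes>\<^sub>M N)"
    by (rule measurable_pair_measure_countable1) auto
  have "integrable (distr M ?S \<tau> \<Otimes>\<^sub>M distr M N Y) (\<lambda>(m, y). H m y)"
    using C by (intro pair.P.integrable_const_bound[where B = C]) auto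
  from pair.integral_fst'[OF this]
  have "(\<integral>m. \<integral>y. H m y \<partial>distr M N Y \<partial>distr M ?S \<tau>)
      = (\<integral>z. (\<lambda>(m, y). H m y) z \<partial>distr M (?S \<Otimes>\<^sub>M N) (\<lambda>\<omega>. (\<tau> \<omega>, Y \<omega>)))"
    by (simp add: joint)
  then show ?thesis
    by (simp add: integral_distr)
qed

section \<open>Clipping unbounded functions\<close>

text \<open>
  Dominated convergence with the bounds \<open>\<bar>U\<bar>\<close>, \<open>\<bar>V\<bar>\<close> and \<open>\<bar>U V\<bar>\<close>, which are integrable because the covariance
  exists.
\<close>
lemma (in prob_space) cov_nonpos_if_clipped:
  assumes ex: "cov_exists M U V"
    and le: "\<And>m :: nat. expectation (\<lambda>\<omega>. clip m (U \<omega>) * clip m (V \<omega>))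
      \<le> expectation (\<lambda>\<omega>. clip m (U \<omega>)) * expectation (\<lambda>\<omega>. clip m (V \<omega>))"
  shows "cov M U V \<le> 0"
proof -
  have int: "integrable M U" "integrable M V" "integrable M (\<lambda>\<omega>. U \<omega> * V \<omega>)"
    using ex by (auto simp: cov_exists_def)
  then have [measurable]: "U \<in> borel_measurable M" "V \<in> borel_measurable M"
    by auto
  have lim_clip: "(\<lambda>m. expectation (\<lambda>\<omega>. clip (real m) (W \<omega>))) \<longlonglongrightarrow> expectation W"
    if W: "integrable M W" for W
    using W by (intro integral_dominated_convergence[where w = "\<lambda>\<omega>. \<bar>W \<omega>\<bar>"])
      (auto simp: clip_tendsto abs_clip_le)
  have "(\<lambda>m. expectation (\<lambda>\<omega>. clip (real m) (U \<omega>) * clip (real m) (V \<omega>)))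
      \<longlonglongrightarrow> expectation (\<lambda>\<omega>. U \<omega> * V \<omega>)"
    using int(3) integrable_abs[OF int(3)] by (intro integral_dominated_convergence[where w = "\<lambda>\<omega>. \<bar>U \<omega> * V \<omega>\<bar>"])
      (auto simp: abs_mult intro!: tendsto_mult clip_tendsto mult_mono abs_clip_le)
  then have "expectation (\<lambda>\<omega>. U \<omega> * V \<omega>) \<le> expectation U * expectation V"
    using le by (intro LIMSEQ_le[OF _ tendsto_mult[OF lim_clip[OF int(1)] lim_clip[OF int(2)]]]) auto
  moreover have "cov M U V = expectation (\<lambda>\<omega>. U \<omega> * V \<omega>) - expectation U * expectation V"
    using int unfolding cov_def by (simp add: algebra_simps prob_space)
  ultimately show ?thesis by simp
qed

section \<open>Negative association of the sampled process\<close>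

text \<open>
  For disjoint sets at most one term of the sum is non-zero, so this is the index of the set that
  contains \<open>x\<close>, or \<open>0\<close> if there is none. As a sum it is visibly measurable.
\<close>
definition block_index :: "nat \<Rightarrow> (nat \<Rightarrow> 'a set) \<Rightarrow> 'a \<Rightarrow> nat" where
  "block_index n B x = (\<Sum>k=1..n. k * of_bool (x \<in> B k))"

lemma block_index_eq:
  assumes "disjoint_family_on B {1..n}" "k \<in> {1..n}" "x \<in> B k"
  shows "block_index n B x = k"
proof -
  have "block_index n B x = (\<Sum>j=1..n. if j = k then k else 0)"
    unfolding block_index_def using assms disjoint_family_onD[OF assms(1) _ assms(2)]
    by (intro sum.cong) auto
  then show ?thesis using assms(2) by simp
qed

lemma block_index_outside: "(\<And>k. k \<in> {1..n} \<Longrightarrow> x \<notin> B k) \<Longrightarrow> block_index n B x = 0"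
  by (auto simp: block_index_def)

lemma block_index_iff:
  assumes "disjoint_family_on B {1..n}" "k \<in> {1..n}"
  shows "block_index n B x = k \<longleftrightarrow> x \<in> B k"
  by (metis assms atLeastAtMost_iff block_index_eq block_index_outside not_one_le_zero)

lemma block_index_le:
  assumes "disjoint_family_on B {1..n}"
  shows "block_index n B x \<le> n"
  by (metis assms atLeastAtMost_iff block_index_eq block_index_outside zero_le)

lemma measurable_block_index:
  assumes "\<And>k. k \<in> {1..n} \<Longrightarrow> B k \<in> sets N"
  shows "block_index n B \<in> measurable N (count_space UNIV)"
  unfolding block_index_def[abs_def] using assms by measurable

lemma emeasure_sampled_process_count:
  fixes X :: "nat \<Rightarrow> 'w \<Rightarrow> 'a::topological_space"
  assumes "B \<in> sets borel"
  shows "emeasure (sampled_process \<tau> X \<omega>) B = of_nat (\<Sum>i=1..\<tau> \<omega>. of_bool (X i \<omega> \<in> B))"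
  unfolding emeasure_sampled_process[OF assms] of_nat_sum using assms
  by (intro sum.cong) (auto simp: indicator_def)

lemma finite_point_process_sampled_process:
  fixes X :: "nat \<Rightarrow> 'w \<Rightarrow> 'a::topological_space"
  assumes X: "\<And>i. i \<ge> 1 \<Longrightarrow> X i \<in> measurable M borel"
    and \<tau>: "\<tau> \<in> measurable M (count_space UNIV)"
  shows "finite_point_process M (sampled_process \<tau> X)"
  unfolding finite_point_process_def
proof (intro conjI ballI)
  fix B :: "'a set" assume B: "B \<in> sets borel"
  then have "(\<lambda>\<omega>. (\<Sum>i=1..m. indicator B (X i \<omega>)) :: ennreal) \<in> borel_measurable M" for m
    using X by (intro borel_measurable_sum measurable_compose[OF _ borel_measurable_indicator]) auto
  from measurable_compose_countable[OF this \<tau>]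
  show "(\<lambda>\<omega>. emeasure (sampled_process \<tau> X \<omega>) B) \<in> borel_measurable M"
    using B by (simp add: emeasure_sampled_process)
qed (auto simp: emeasure_sampled_process_count)

theorem theorem3p3:
  fixes M :: "'w measure" and F :: "'a::polish_space measure"
    and X :: "nat \<Rightarrow> 'w \<Rightarrow> 'a" and \<tau> :: "'w \<Rightarrow> nat"
  assumes "prob_space M"
    and "\<And>i. i \<ge> 1 \<Longrightarrow> X i \<in> measurable M borel"
    and "\<And>i. i \<ge> 1 \<Longrightarrow> distr M borel (X i) = F"
    and "prob_space.indep_vars M (\<lambda>_. borel) X {1..}"
    and "\<tau> \<in> measurable M (count_space UNIV)"
    and "prob_space.indep_set M
           (sets (vimage_algebra (space M) \<tau> (count_space UNIV)))
           (sets (vimage_algebra (space M) (\<lambda>\<omega>. \<lambda>i\<in>{1..}. X i \<omega>) (PiM {1..} (\<lambda>_. borel))))"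
    and "distr M borel (\<lambda>\<omega>. real (\<tau> \<omega>)) \<in> class_Q"
  shows "na_point_process M (sampled_process \<tau> X)"
  unfolding na_point_process_def na_vector_def
proof (intro conjI allI impI)
  interpret prob_space M by fact
  note X [measurable] = assms(2) and \<tau> [measurable] = assms(5)
  show "finite_point_process M (sampled_process \<tau> X)"
    using X \<tau> by (rule finite_point_process_sampled_process)
  fix n :: nat and B :: "nat \<Rightarrow> 'a set" and A and f g :: "(nat \<Rightarrow> real) \<Rightarrow> real"
  let ?Y = "\<lambda>i \<omega>. measure (sampled_process \<tau> X \<omega>) (B i)"
  let ?A' = "{1..n} - A"
  assume B: "\<forall>i\<in>{1..n}. B i \<in> sets borel" and disj: "disjoint_family_on B {1..n}"
    and A: "A \<subseteq> {1..n}"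
    and f: "mono_on (A \<rightarrow>\<^sub>E UNIV) f" and g: "mono_on (?A' \<rightarrow>\<^sub>E UNIV) g"
    and ex: "cov_exists M (\<lambda>\<omega>. f (\<lambda>i\<in>A. ?Y i \<omega>)) (\<lambda>\<omega>. g (\<lambda>j\<in>?A'. ?Y j \<omega>))"

  let ?\<kappa> = "block_index n B"
  define p :: "nat \<Rightarrow> real" where "p k = (\<integral>x. of_bool (?\<kappa> x = k) \<partial>F)" for k
  have \<kappa> [measurable]: "?\<kappa> \<in> measurable borel (count_space UNIV)"
    using B by (intro measurable_block_index) auto
  have F [measurable_cong]: "sets F = sets borel"
    using assms(3)[of 1] by (metis le_refl sets_distr)
  interpret F: prob_space F
    using prob_space_distr[OF X[of 1]] assms(3)[of 1] by simp
  have int_\<kappa>: "integrable F (\<lambda>x. of_bool (?\<kappa> x = k) :: real)" for k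
    by (rule F.integrable_const_bound[where B = 1]) auto
  interpret sampling_weights n p
  proof
    show "0 \<le> p k" for k by (simp add: p_def)
    have "(\<Sum>k\<le>n. of_bool (?\<kappa> x = k)) = (1 :: real)" for x
    proof -
      have "(\<Sum>k\<le>n. of_bool (?\<kappa> x = k)) = (\<Sum>k\<le>n. if k = ?\<kappa> x then 1 else 0 :: real)"
        by (intro sum.cong) auto
      then show ?thesis using block_index_le[OF disj] by simp
    qed
    then show "(\<Sum>k\<le>n. p k) = 1"
      using Bochner_Integration.integral_sum[of "{..n}" F "\<lambda>k x. of_bool (?\<kappa> x = k) :: real"] int_\<kappa>
      by (simp add: p_def F.prob_space del: sum_of_bool_eq)
  qed

  let ?S = "\<lambda>\<omega>. counts ?\<kappa> (\<tau> \<omega>) (\<lambda>i. X i \<omega>)"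
  let ?PX = "PiM {1..} (\<lambda>_. borel) :: (nat \<Rightarrow> 'a) measure"
  have Y: "?Y i \<omega> = real (?S \<omega> i)" if "i \<in> {1..n}" for i \<omega>
    using that B unfolding measure_def
    by (simp add: emeasure_sampled_process_count counts_eq_sum block_index_iff[OF disj that]
        del: sum_of_bool_eq of_nat_sum)

  have "(\<lambda>\<omega>. \<lambda>i\<in>{1..}. X i \<omega>) \<in> measurable M ?PX"
    by (rule measurable_restrict) (auto intro: X)
  \<comment> \<open>The mean of any bounded function of the counts is the integral, against the law of \<open>\<tau>\<close>, of a
    function on the naturals extended by rounding, as required by \<open>class_Q_mult_le\<close>.\<close>
  note indep = expectation_indep_nat[OF \<tau> this assms(6)]
  have mean: "expectation (\<lambda>\<omega>. h (?S \<omega>))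
      = (\<integral>x. (sample ^^ nat (round x)) h (\<lambda>_. 0) \<partial>distr M borel (\<lambda>\<omega>. real (\<tau> \<omega>)))"
    if h: "\<And>s. \<bar>h s\<bar> \<le> C" for h C
  proof -
    have restrict: "counts ?\<kappa> m (\<lambda>i\<in>{1..}. x i) = counts ?\<kappa> m x" for m x
      by (rule counts_restrict) auto
    have weight: "(\<integral>\<omega>. of_bool (?\<kappa> (X i \<omega>) = k) \<partial>M) = p k" if "1 \<le> i" for i k
      unfolding p_def assms(3)[OF that, symmetric] using X[OF that]
      by (subst integral_distr) auto
    have "expectation (\<lambda>\<omega>. h (?S \<omega>))
        = expectation (\<lambda>\<omega>. \<integral>\<omega>'. h (counts ?\<kappa> (\<tau> \<omega>) (\<lambda>i. X i \<omega>')) \<partial>M)"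
      using indep[where H = "\<lambda>m x. h (counts ?\<kappa> m x)" and C = C] borel_measurable_counts[OF \<kappa>] h
      unfolding restrict by auto
    also have "\<dots> = expectation (\<lambda>\<omega>. (sample ^^ \<tau> \<omega>) h (\<lambda>_. 0))"
      using expectation_counts[where h = h and C = C,
          OF assms(1,4) \<kappa> block_index_le[OF disj] weight h]
      by simp
    also have "\<dots> = (\<integral>x. (sample ^^ nat (round x)) h (\<lambda>_. 0) \<partial>distr M borel (\<lambda>\<omega>. real (\<tau> \<omega>)))"
      using borel_measurable_nat_round[of "\<lambda>m. (sample ^^ m) h (\<lambda>_. 0)"]
      by (subst integral_distr) auto
    finally show ?thesis .
  qed

  let ?f = "\<lambda>s. f (\<lambda>i\<in>A. real (s i))" and ?g = "\<lambda>s. g (\<lambda>i\<in>?A'. real (s i))"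
  have U: "(\<lambda>\<omega>. f (\<lambda>i\<in>A. ?Y i \<omega>)) = (\<lambda>\<omega>. ?f (?S \<omega>))"
    using A Y by (intro ext arg_cong[where f = f] restrict_ext) auto
  have V: "(\<lambda>\<omega>. g (\<lambda>i\<in>?A'. ?Y i \<omega>)) = (\<lambda>\<omega>. ?g (?S \<omega>))"
    using Y by (intro ext arg_cong[where f = g] restrict_ext) auto
  show "cov M (\<lambda>\<omega>. f (\<lambda>i\<in>A. ?Y i \<omega>)) (\<lambda>\<omega>. g (\<lambda>j\<in>?A'. ?Y j \<omega>)) \<le> 0"
    unfolding U V
  proof (rule cov_nonpos_if_clipped[OF ex[unfolded U V]])
    fix m :: nat
    have bound: "\<bar>clip (real m) x\<bar> \<le> real m" "\<bar>clip (real m) x * clip (real m) y\<bar> \<le> real m * real m"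
      for x y
      using abs_clip_le(1)[of "real m"] by (auto simp: abs_mult intro!: mult_mono)
    show "expectation (\<lambda>\<omega>. clip m (?f (?S \<omega>)) * clip m (?g (?S \<omega>)))
      \<le> expectation (\<lambda>\<omega>. clip m (?f (?S \<omega>))) * expectation (\<lambda>\<omega>. clip m (?g (?S \<omega>)))"
      using class_Q_mult_le[OF assms(7)
          increases_in_clip[OF increases_in_restrict[OF f]] bound(1)
          increases_in_clip[OF increases_in_restrict[OF g]] bound(1)]
      by (subst (1 2 3) mean) (auto intro: bound)
  qed
qed

end
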